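(* Let $S=\langle\langle A_0\mid \mathcal{R}_0\rangle\rangle$ be the finitely presented semigroup (monoid) with generating alphabet $A_0=\{0,1,\bar 0,\bar 1,h_0,h_1,h_2,c,w\}$ and defining relations $\ell=r$ for the following pairs $\ell\to r$ (the set $\mathcal{R}_0$): $$h_0 1\to\bar 0 h_1,\quad h_1 1\to\bar 1 h_2,\quad h_2 1\to\bar 0 h_1,\quad h_0 0\to\bar 0 h_0,\quad h_1 0\to\bar 0 h_1,\quad h_2 0\to\bar 0 h_2,$$ $$h_1 w\to cw,\quad h_2 w\to cw,\quad \bar 0 c\to c0,\quad \bar 1 c\to c1,\quad wc\to wh_0.$$ Then the Dehn function of $S$ is equivalent to $n\log n$: $D_S(n)\sim n\log n$.
   Context: For an alphabet $A$, $A^*$ is the set of all finite words (including the empty word), and $|u|$ is the length of $u$. For a set $\mathcal{R}$ of rules $\ell\to r$ with $\ell,r\in A^*$, write $u\to_{\mathcal R}v$ if $u=\alpha \ell\beta$ and $v=\alpha r\beta$ for some rule $\ell\to r$ in $\mathcal{R}$ and some $\alpha,\beta\in A^*$. Let $\leftrightarrow^*_{\mathcal R}$ be the reflexive, symmetric and transitive closure of $\to_{\mathcal R}$; $\langle\langle A\mid\mathcal{R}\rangle\rangle$ is the set of equivalence classes of $\leftrightarrow^*_{\mathcal R}$ with the operation induced by concatenation. For $u\leftrightarrow^*_{\mathcal R}v$, the distance $d_{\mathcal R}(u,v)$ is the minimal number of applications of rules of $\mathcal{R}$, each in either direction, needed to obtain $v$ from $u$. The Dehn function of $S=\langle\langle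 A\mid\mathcal{R}\rangle\rangle$ (with $A$, $\mathcal{R}$ finite) is $D_S(n)=\max\{d_{\mathcal R}(u,v)\mid u,v\in A^*,\ u\leftrightarrow^*_{\mathcal R}v,\ |u|+|v|\le n\}$. For non-decreasing functions $f,g$ on the positive integers with non-negative real values, $f\preceq g$ means there is a constant $c>0$ such that for every $n$ greater than some $N$ one has $f(n)\le c\,g(cn)+cn+c$ (here $c$ may be taken to be a positive integer, so that $cn$ is a positive integer). $f\sim g$ means $f\preceq g$ and $g\preceq f$. $\log=\log_2$. *)

theory Defs
  imports Complex_Main
begin

section \<open>String rewriting and Dehn functions\<close>

text \<open>The alphabet is the whole type \<open>'a\<close>, so the set of words is \<open>UNIV :: 'a list set\<close>.\<close>

type_synonym 'a rules = "('a list \<times> 'a list) set"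

definition rewrite_step :: "'a rules \<Rightarrow> 'a list \<Rightarrow> 'a list \<Rightarrow> bool" where
  "rewrite_step R u v \<longleftrightarrow>
     (\<exists>\<alpha> \<beta> l r. (l, r) \<in> R \<and> u = \<alpha> @ l @ \<beta> \<and> v = \<alpha> @ r @ \<beta>)"

definition rewrite_equiv :: "'a rules \<Rightarrow> 'a list \<Rightarrow> 'a list \<Rightarrow> bool" where
  "rewrite_equiv R = equivclp (rewrite_step R)"

text \<open>Only meaningful for equivalent words; otherwise \<open>LEAST\<close> ranges over an empty set.\<close>

definition rewrite_dist :: "'a rules \<Rightarrow> 'a list \<Rightarrow> 'a list \<Rightarrow> nat" where
  "rewrite_dist R u v = (LEAST k. (symclp (rewrite_step R) ^^ k) u v)"

definition dehn :: "'a::finite rules \<Rightarrow> nat \<Rightarrow> nat" where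
  "dehn R n = Max {rewrite_dist R u v | u v. rewrite_equiv R u v \<and> length u + length v \<le> n}"

text \<open>The maximum in \<open>dehn\<close> is taken over a finite non-empty set, and the distance
  of equivalent words is attained.\<close>

lemma finite_dehn_set:
  fixes R :: "'a::finite rules"
  shows "finite {rewrite_dist R u v | u v. rewrite_equiv R u v \<and> length u + length v \<le> n}"
proof -
  have "finite {u :: 'a list. length u \<le> n}"
    using finite_lists_length_le[of "UNIV :: 'a set" n] by simp
  then have "finite ((\<lambda>(u, v). rewrite_dist R u v) `
      ({u :: 'a list. length u \<le> n} \<times> {v. length v \<le> n}))"
    by simp
  then show ?thesis
    by (rule rev_finite_subset) auto
qed

lemma dehn_set_nonempty:
  "{rewrite_dist R u v | u v. rewrite_equiv R u v \<and> length u + length v \<le> n} \<noteq> {}"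
proof -
  have "rewrite_equiv R [] [] \<and> length ([] :: 'a list) + length ([] :: 'a list) \<le> n"
    by (simp add: rewrite_equiv_def)
  then show ?thesis by blast
qed

lemma rewrite_dist_attained:
  assumes "rewrite_equiv R u v"
  shows "(symclp (rewrite_step R) ^^ rewrite_dist R u v) u v"
proof -
  have "(symclp (rewrite_step R))\<^sup>*\<^sup>* u v"
    using assms by (simp add: rewrite_equiv_def equivclp_def)
  then have "\<exists>k. (symclp (rewrite_step R) ^^ k) u v"
    by (simp add: rtranclp_is_Sup_relpowp)
  then show ?thesis
    unfolding rewrite_dist_def by (rule LeastI_ex)
qed

section \<open>Comparison of growth\<close>

text \<open>Functions on the positive integers; the value at \<open>0\<close> is irrelevant, since
  \<open>n > N\<close> forces \<open>n > 0\<close>.\<close>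

definition growth_le :: "(nat \<Rightarrow> real) \<Rightarrow> (nat \<Rightarrow> real) \<Rightarrow> bool" where
  "growth_le f g \<longleftrightarrow>
     (\<exists>c::nat. c > 0 \<and> (\<exists>N::nat. \<forall>n>N.
        f n \<le> real c * g (c * n) + real c * real n + real c))"

definition growth_equiv :: "(nat \<Rightarrow> real) \<Rightarrow> (nat \<Rightarrow> real) \<Rightarrow> bool" where
  "growth_equiv f g \<longleftrightarrow> growth_le f g \<and> growth_le g f"

section \<open>The presentation\<close>

text \<open>\<open>Z, I\<close> are the letters \<open>0, 1\<close>, and \<open>Zb, Ib\<close> their barred copies.\<close>

datatype letter = Z | I | Zb | Ib | H0 | H1 | H2 | C | W

instance letter :: finite
proof
  have "(UNIV :: letter set) \<subseteq> {Z, I, Zb, Ib, H0, H1, H2, C, W}"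
    using letter.exhaust by blast
  then show "finite (UNIV :: letter set)"
    by (rule finite_subset) simp
qed

definition rules0 :: "letter rules" where
  "rules0 =
    {([H0, I], [Zb, H1]), ([H1, I], [Ib, H2]), ([H2, I], [Zb, H1]),
     ([H0, Z], [Zb, H0]), ([H1, Z], [Zb, H1]), ([H2, Z], [Zb, H2]),
     ([H1, W], [C, W]), ([H2, W], [C, W]),
     ([Zb, C], [C, Z]), ([Ib, C], [C, I]),
     ([W, C], [W, H0])}"

end

theory Submission
  imports Defs
begin

text \<open>
  The rules describe a machine working between two letters \<open>W\<close>. A head \<open>H0\<close>, \<open>H1\<close> or \<open>H2\<close> moves
  to the right over the letters \<open>Z\<close>, \<open>I\<close>, puts bars on them and erases every other \<open>I\<close>: in
  state \<open>H1\<close> the number of ones read so far is odd, in \<open>H2\<close> it is even and positive, in \<open>H0\<close> it is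
  zero. At the right \<open>W\<close>, a head that has seen a one becomes \<open>C\<close>, which travels back, removes the
  bars, and is turned into \<open>H0\<close> again at the left \<open>W\<close>. A round trip over \<open>n\<close> letters takes
  \<open>2 n + 2\<close> steps and halves the number of ones, so that about \<open>n log n\<close> steps are made before
  the machine stops.

  The link between derivations and distances is a strong form of confluence: two different results
  of one step have a common result of one further step each (\<open>diamond_step\<close>). Left-hand sides
  overlap only in a letter \<open>W\<close>, and the rules leave \<open>W\<close> in place, so that steps at different places
  do not disturb each other. It follows that all derivations from a word to its normal form have the
  same length, and that this length changes by exactly one along each edge of the rewriting graph
  (\<open>random_descent\<close>). Hence the distance of a word to its normal form is the length of any
  derivation, and the distance of two equivalent words is at most the sum of the lengths of their
  derivations.

  For the lower bound it therefore suffices to exhibit one long derivation to a normal form,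
  namely the run of the machine on \<open>n\<close> ones (\<open>long_derivation\<close>). For the upper bound, the length of
  a derivation from an arbitrary word is bounded by a potential (\<open>potential_decreases\<close>). The letters
  \<open>W\<close> cut the word into segments that do not interact. In a segment, the potential combines a
  bound on the number of turns at the ends that are still to come with the number of letters that
  can be crossed before the next turn. Turns are few: if there are two or more heads, the outermost
  ones shield each other and each of them turns at most once, and a single head loses
  half of the ones in each round trip. This gives a logarithmic number of turns and hence a potential
  of order \<open>n log n\<close> (\<open>potential_le\<close>).\<close>

section \<open>Random descent\<close>

definition diamond :: "('a \<Rightarrow> 'a \<Rightarrow> bool) \<Rightarrow> bool" where
  "diamond r \<longleftrightarrow> (\<forall>u v v'. r u v \<longrightarrow> r u v' \<longrightarrow> v = v' \<or> (\<exists>t. r v t \<and> r v' t))"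

abbreviation normal :: "('a \<Rightarrow> 'a \<Rightarrow> bool) \<Rightarrow> 'a \<Rightarrow> bool" where
  "normal r t \<equiv> (\<nexists>s. r t s)"

text \<open>The first step of any derivation to a normal form may be replaced by any other step without a
  change in length: the two results meet after one step, and the induction carries the shorter derivation
  around that diamond.\<close>
lemma random_descent:
  assumes diamond: "diamond r" and normal: "normal r t"
  shows "(r ^^ a) u t \<Longrightarrow> r u v \<Longrightarrow> \<exists>b. a = Suc b \<and> (r ^^ b) v t"
proof (induction a arbitrary: u v)
  case 0
  then show ?case using normal by simp
next
  case (Suc a)
  obtain u' where u': "r u u'" "(r ^^ a) u' t"
    using Suc.prems(1) by (meson relpowp_Suc_D2)
  show ?case
  proof (cases "v = u'")
    case True
    then show ?thesis using u' by blast
  next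
    case False
    then obtain s where s: "r v s" "r u' s"
      using diamond Suc.prems(2) u'(1) unfolding diamond_def by blast
    obtain b where b: "a = Suc b" "(r ^^ b) s t"
      using Suc.IH[OF u'(2) s(2)] by blast
    have "(r ^^ Suc b) v t"
      using s(1) b(2) by (rule relpowp_Suc_I2)
    then show ?thesis using b(1) by blast
  qed
qed

lemma descent_length_unique:
  assumes diamond: "diamond r" and normal: "normal r t"
  shows "(r ^^ a) u t \<Longrightarrow> (r ^^ b) u t \<Longrightarrow> a = b"
proof (induction a arbitrary: u b)
  case 0
  then show ?case using normal by (cases b) (auto simp del: relpowp.simps(2) dest!: relpowp_Suc_D2)
next
  case (Suc a)
  obtain v where v: "r u v" "(r ^^ a) v t"
    using Suc.prems(1) by (meson relpowp_Suc_D2)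
  obtain b' where "b = Suc b'" "(r ^^ b') v t"
    using random_descent[OF diamond normal Suc.prems(2) v(1)] by blast
  then show ?case using Suc.IH[OF v(2)] by simp
qed

text \<open>The derivation length to \<open>t\<close> grows by one on a step against the rules, and shrinks by
  one on a step along them, so a path of length \<open>k\<close> changes it by at most \<open>k\<close>. With
  \<open>b = 0\<close> this bounds distances from below; for arbitrary \<open>b\<close> it shows that
  equivalent words have the same normal form.\<close>
lemma descent_along_zigzag:
  assumes diamond: "diamond r" and normal: "normal r t"
    and t: "(r ^^ b) v t"
  shows "(symclp r ^^ k) u v \<Longrightarrow> \<exists>a \<le> b + k. (r ^^ a) u t"
proof (induction k arbitrary: u)
  case 0
  then show ?case using t by auto
next
  case (Suc k)
  obtain u' where u': "symclp r u u'" "(symclp r ^^ k) u' v"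
    using Suc.prems by (meson relpowp_Suc_D2)
  obtain a where a: "a \<le> b + k" "(r ^^ a) u' t"
    using Suc.IH[OF u'(2)] by blast
  from u'(1) show ?case
  proof (cases rule: symclpE)
    case base
    then have "(r ^^ Suc a) u t" using a(2) by (rule relpowp_Suc_I2)
    then show ?thesis using a(1) by (intro exI[of _ "Suc a"]) simp
  next
    case sym
    then obtain a' where "a = Suc a'" "(r ^^ a') u t"
      using random_descent[OF diamond normal a(2)] by blast
    then show ?thesis using a(1) by (intro exI[of _ a']) simp
  qed
qed

lemma relpowp_le_potential:
  fixes \<Phi> :: "'a \<Rightarrow> nat"
  assumes "\<And>u v. r u v \<Longrightarrow> \<Phi> v < \<Phi> u"
  shows "(r ^^ a) u v \<Longrightarrow> a \<le> \<Phi> u"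
proof (induction a arbitrary: u)
  case (Suc a)
  then obtain u' where "r u u'" "(r ^^ a) u' v"
    by (meson relpowp_Suc_D2)
  then show ?case using Suc.IH assms by fastforce
qed simp

lemma ex_normal_form:
  fixes \<Phi> :: "'a \<Rightarrow> nat"
  assumes "\<And>u v. r u v \<Longrightarrow> \<Phi> v < \<Phi> u"
  shows "\<exists>a t. (r ^^ a) u t \<and> normal r t"
proof (induction u rule: measure_induct_rule[of \<Phi>])
  case (less u)
  show ?case
  proof (cases "\<exists>v. r u v")
    case True
    then obtain v where v: "r u v" by blast
    then obtain a t where "(r ^^ a) v t" "normal r t"
      using less assms by blast
    then show ?thesis using v by (meson relpowp_Suc_I2)
  next
    case False
    then show ?thesis by (intro exI[of _ 0]) auto
  qed
qed

lemma relpowp_symclp: "(r ^^ a) u v \<Longrightarrow> (symclp r ^^ a) u v"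
  by (rule relpowp_mono[of r "symclp r"]) auto

lemma relpowp_symclp_sym: "(symclp r ^^ a) u v \<Longrightarrow> (symclp r ^^ a) v u"
proof (induction a arbitrary: v)
  case (Suc a)
  then obtain v' where "(symclp r ^^ a) u v'" "symclp r v' v"
    by (meson relpowp_Suc_E)
  then show ?case
    by (meson Suc.IH relpowp_Suc_I2 symp_on_symclp sympD)
qed simp

lemma relpowp_add_I: "(r ^^ a) u v \<Longrightarrow> (r ^^ b) v w \<Longrightarrow> (r ^^ (a + b)) u w"
  by (auto simp: relpowp_add)

section \<open>One step of the rewriting system\<close>

abbreviation step :: "letter list \<Rightarrow> letter list \<Rightarrow> bool" where
  "step \<equiv> rewrite_step rules0"

lemma rules0_pair:
  assumes "(l, r) \<in> rules0"
  obtains a b c d where "l = [a, b]" "r = [c, d]"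
  using assms unfolding rules0_def by auto

lemma step_head: "([a, b], [c, d]) \<in> rules0 \<Longrightarrow> step (a # b # \<beta>) (c # d # \<beta>)"
  unfolding rewrite_step_def by (metis append_Cons append_Nil)

lemma step_context: "step u v \<Longrightarrow> step (\<alpha> @ u @ \<beta>) (\<alpha> @ v @ \<beta>)"
  unfolding rewrite_step_def by (metis append.assoc)

lemma step_Cons: "step u v \<Longrightarrow> step (a # u) (a # v)"
  using step_context[of u v "[a]" "[]"] by simp

lemma step_cases [consumes 1, case_names head tail]:
  assumes "step u v"
  obtains a b c d \<beta> where "u = a # b # \<beta>" "v = c # d # \<beta>" "([a, b], [c, d]) \<in> rules0"
  | a u' v' where "u = a # u'" "v = a # v'" "step u' v'"
proof -
  obtain \<alpha> \<beta> l r where lr: "(l, r) \<in> rules0" "u = \<alpha> @ l @ \<beta>" "v = \<alpha> @ r @ \<beta>"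
    using assms unfolding rewrite_step_def by blast
  obtain a b c d where ab: "l = [a, b]" "r = [c, d]"
    using lr(1) by (rule rules0_pair)
  show ?thesis
  proof (cases \<alpha>)
    case Nil
    then show ?thesis using that(1) lr ab by simp
  next
    case (Cons x \<alpha>')
    have "step (\<alpha>' @ l @ \<beta>) (\<alpha>' @ r @ \<beta>)"
      using lr(1) unfolding rewrite_step_def by blast
    then show ?thesis using that(2) lr Cons by simp
  qed
qed

lemma rules0_deterministic:
  "(l, r) \<in> rules0 \<Longrightarrow> (l, r') \<in> rules0 \<Longrightarrow> r = r'"
  unfolding rules0_def by auto

text \<open>Two left-hand sides can only share a letter \<open>W\<close>, which both rules keep; this is the
  reason for the diamond property.\<close>
lemma rules0_overlap:
  assumes "([a, b], [c, d]) \<in> rules0" "([b, e], [f, g]) \<in> rules0"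
  shows "d = b \<and> f = b"
  using assms unfolding rules0_def by auto

lemma diamond_head_tail:
  assumes "([a, b], [c, d]) \<in> rules0" "step (b # \<beta>) v"
  shows "\<exists>t. step (c # d # \<beta>) t \<and> step (a # v) t"
  using assms(2)
proof (cases rule: step_cases)
  case (head b' e f g \<gamma>)
  then have be: "\<beta> = e # \<gamma>" "v = f # g # \<gamma>" "([b, e], [f, g]) \<in> rules0"
    by auto
  have "d = b" "f = b"
    using rules0_overlap[OF assms(1) be(3)] by auto
  then have "step (c # d # \<beta>) (c # b # g # \<gamma>)" "step (a # v) (c # b # g # \<gamma>)"
    using be assms(1) by (auto intro: step_head step_Cons)
  then show ?thesis by blast
next
  case (tail b' \<beta>' v')
  then have "step (c # d # \<beta>) (c # d # v')" "step (a # v) (c # d # v')"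
    using assms(1) by (auto intro: step_head step_Cons)
  then show ?thesis by blast
qed

lemma step_joinable:
  "step u v \<Longrightarrow> step u v' \<Longrightarrow> v = v' \<or> (\<exists>t. step v t \<and> step v' t)"
proof (induction u arbitrary: v v')
  case Nil
  then show ?case by (auto elim: step_cases)
next
  case (Cons x u)
  from Cons.prems(1) show ?case
  proof (cases rule: step_cases)
    case h1: (head a b c d \<beta>)
    from Cons.prems(2) show ?thesis
    proof (cases rule: step_cases)
      case (head a' b' c' d' \<beta>')
      then show ?thesis using h1 rules0_deterministic by fastforce
    next
      case (tail a' u' w')
      then show ?thesis using h1 diamond_head_tail[of a b c d \<beta> w'] by auto
    qed
  next
    case t1: (tail a u1 w)
    from Cons.prems(2) show ?thesis
    proof (cases rule: step_cases)
      case (head a' b' c' d' \<beta>')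
      then show ?thesis using t1 diamond_head_tail[of a' b' c' d' \<beta>' w] by auto
    next
      case (tail a' u' w')
      then have "w = w' \<or> (\<exists>t. step w t \<and> step w' t)"
        using Cons.IH t1 by auto
      then show ?thesis using t1 tail by (auto intro: step_Cons)
    qed
  qed
qed

lemma diamond_step: "diamond step"
  unfolding diamond_def using step_joinable by blast

section \<open>Counting ones and binary digits\<close>

fun bits :: "nat \<Rightarrow> nat" where
  "bits m = (if m = 0 then 0 else Suc (bits (m div 2)))"

declare bits.simps [simp del]

lemma bits_0 [simp]: "bits 0 = 0"
  by (simp add: bits.simps)

lemma bits_pos: "m > 0 \<Longrightarrow> bits m = Suc (bits (m div 2))"
  using bits.simps by simp

lemma bits_mono: "m \<le> n \<Longrightarrow> bits m \<le> bits n"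
proof (induction m arbitrary: n rule: bits.induct)
  case (1 m)
  show ?case
  proof (cases "m = 0")
    case False
    then have "bits (m div 2) \<le> bits (n div 2)"
      using 1 by (simp add: div_le_mono)
    then show ?thesis using False 1(2) by (simp add: bits_pos)
  qed simp
qed

lemma less_2_power_bits: "m < 2 ^ bits m"
proof (induction m rule: bits.induct)
  case (1 m)
  then show ?case by (cases "m = 0") (auto simp: bits_pos)
qed

lemma two_power_bits_le: "m > 0 \<Longrightarrow> 2 ^ bits m \<le> 2 * m"
proof (induction m rule: bits.induct)
  case (1 m)
  show ?case
  proof (cases "m div 2 = 0")
    case True
    then show ?thesis using 1(2) by (simp add: bits_pos)
  next
    case False
    then have "2 ^ bits (m div 2) \<le> 2 * (m div 2)" using 1 by simp
    then show ?thesis using 1(2) by (simp add: bits_pos)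
  qed
qed

lemma log_le_bits: "m > 0 \<Longrightarrow> log 2 (real m) \<le> real (bits m)"
  using less_2_power_bits[of m] by (simp add: log_le_iff powr_realpow less_imp_le flip: of_nat_power)

lemma bits_le_log: 
  assumes "m > 0"
  shows "real (bits m) \<le> 1 + log 2 (real m)"
proof -
  have "real (2 ^ bits m) \<le> real (2 * m)"
    using two_power_bits_le[OF assms] by (simp only: of_nat_le_iff)
  then have "2 powr real (bits m) \<le> 2 * real m"
    by (simp add: powr_realpow)
  then have "real (bits m) \<le> log 2 (2 * real m)"
    using assms by (simp add: le_log_iff)
  then show ?thesis using assms by (simp add: log_mult)
qed

text \<open>The count includes barred ones, since bars only record which letters have been passed.\<close>
definition ones :: "letter list \<Rightarrow> nat" where
  "ones s = count_list s I + count_list s Ib"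

lemma ones_simps [simp]:
  "ones [] = 0"
  "ones (a # s) = (if a = I \<or> a = Ib then Suc (ones s) else ones s)"
  "ones (s @ s') = ones s + ones s'"
  by (auto simp: ones_def)

lemma ones_le_length: "ones s \<le> length s"
  by (induction s) auto

section \<open>The potential of a segment\<close>

definition is_head :: "letter \<Rightarrow> bool" where
  "is_head a \<longleftrightarrow> a \<in> {H0, H1, H2, C}"

lemma is_head_simps [simp]:
  "is_head H0" "is_head H1" "is_head H2" "is_head C"
  "\<not> is_head Z" "\<not> is_head I" "\<not> is_head Zb" "\<not> is_head Ib" "\<not> is_head W"
  by (auto simp: is_head_def)

text \<open>With \<open>b = False\<close>, the number of letters in \<open>T\<close> whose nearest head to the
  left is in \<open>P\<close>; the flag \<open>b\<close> says whether the nearest head to the left of the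
  whole word is in \<open>P\<close>, as needed for a word that is read in two parts.\<close>
fun exposed :: "letter set \<Rightarrow> letter set \<Rightarrow> bool \<Rightarrow> letter list \<Rightarrow> nat" where
  "exposed P T b [] = 0"
| "exposed P T b (a # s) =
    (if is_head a then exposed P T (a \<in> P) s else of_bool (b \<and> a \<in> T) + exposed P T b s)"

fun facing :: "letter set \<Rightarrow> bool \<Rightarrow> letter list \<Rightarrow> bool" where
  "facing P b [] = b"
| "facing P b (a # s) = facing P (if is_head a then a \<in> P else b) s"

lemma exposed_append:
  "exposed P T b (s @ s') = exposed P T b s + exposed P T (facing P b s) s'"
  by (induction s arbitrary: b) auto

lemma exposed_le: "exposed P T b s \<le> length (filter (\<lambda>a. a \<in> T) s)"
  by (induction s arbitrary: b) (auto simp: le_SucI)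

text \<open>An unbarred letter can be crossed by the nearest head on its left, if that is moving right, and a
  barred one by the nearest head on its right, if that is \<open>C\<close>. A letter that has just been
  crossed has the crossing head on its wrong side, so it stops being counted until a head turns.\<close>
definition crossable :: "letter list \<Rightarrow> nat" where
  "crossable s = exposed {H0, H1, H2} {Z, I} False s + exposed {C} {Zb, Ib} False (rev s)"

lemma crossable_le: "crossable s \<le> length s"
proof -
  have "exposed {C} {Zb, Ib} False (rev s) \<le> length (filter (\<lambda>a. a \<in> {Zb, Ib}) s)"
    using exposed_le[of "{C}" "{Zb, Ib}" False "rev s"] by (simp flip: rev_filter)
  moreover have "length (filter (\<lambda>a. a \<in> {Z, I}) s) + length (filter (\<lambda>a. a \<in> {Zb, Ib}) s) \<le> length s"
    by (induction s) auto
  ultimately show ?thesis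
    using exposed_le[of "{H0, H1, H2}" "{Z, I}" False s] unfolding crossable_def by linarith
qed

text \<open>The rules by which a head passes one letter; the remaining rules turn a head next to a
  \<open>W\<close>.\<close>
definition crossing :: "letter rules" where
  "crossing =
    {([H0, I], [Zb, H1]), ([H1, I], [Ib, H2]), ([H2, I], [Zb, H1]),
     ([H0, Z], [Zb, H0]), ([H1, Z], [Zb, H1]), ([H2, Z], [Zb, H2]),
     ([Zb, C], [C, Z]), ([Ib, C], [C, I])}"

lemma crossable_crossing:
  assumes "(l, r) \<in> crossing"
  shows "crossable (\<alpha> @ l @ \<beta>) = Suc (crossable (\<alpha> @ r @ \<beta>))"
  using assms unfolding crossing_def crossable_def
  by (auto simp: exposed_append)

text \<open>For a single head with \<open>x\<close> ones to its left and \<open>y\<close> to its right, a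
  bound on the number of turns to come. The arguments of \<open>bits\<close> are the numbers of ones that
  there will be when the head reaches the end towards which it moves; these do not change when the head
  crosses a letter. A number \<open>m\<close> of ones is good for \<open>bits m\<close> more round trips of
  two turns each. In state \<open>H0\<close> with no ones ahead, the head stops at the right end.\<close>
fun turns_single :: "letter \<Rightarrow> nat \<Rightarrow> nat \<Rightarrow> nat" where
  "turns_single H0 x y = (if y = 0 then 0 else 2 * bits (x + y div 2) + 2)"
| "turns_single H1 x y = 2 * bits (x + (y + 1) div 2) + 2"
| "turns_single H2 x y = 2 * bits (x + y div 2) + 2"
| "turns_single C x y = 2 * bits (x + y) + 1"
| "turns_single _ x y = 0"

text \<open>If there are several heads, only the first one can reach the left end and only the last one the
  right end, and after turning there they are separated from the other end by another head.\<close>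
definition turns :: "letter list \<Rightarrow> nat" where
  "turns s =
    (let ps = filter is_head s in
     if ps = [] then 0
     else if tl ps = []
       then turns_single (hd ps)
         (ones (takeWhile (\<lambda>a. \<not> is_head a) s)) (ones (dropWhile (\<lambda>a. \<not> is_head a) s))
     else of_bool (hd ps = C) + of_bool (last ps \<noteq> C))"

lemma turns_one_head:
  assumes "is_head p" "\<forall>a\<in>set x. \<not> is_head a" "\<forall>a\<in>set y. \<not> is_head a"
  shows "turns (x @ p # y) = turns_single p (ones x) (ones y)"
proof -
  have "filter is_head x = []" "filter is_head y = []"
    using assms by (auto simp: filter_empty_conv)
  moreover have "takeWhile (\<lambda>a. \<not> is_head a) (x @ p # y) = x"
     "dropWhile (\<lambda>a. \<not> is_head a) (x @ p # y) = p # y"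
    using assms by (auto simp: takeWhile_append dropWhile_append)
  ultimately show ?thesis using assms(1) unfolding turns_def by auto
qed

lemma turns_many_heads:
  assumes "filter is_head s = q @ p # q'" "q @ q' \<noteq> []"
  shows "turns s = of_bool (hd (q @ [p]) = C) + of_bool (last (p # q') \<noteq> C)"
  using assms unfolding turns_def by (cases q) (auto simp: Let_def)

lemma turns_le: "turns s \<le> 2 * bits (length s) + 2"
proof -
  have *: "turns_single p x y \<le> 2 * bits n + 2" if "x + y \<le> n" for p x y n
  proof -
    have "bits (x + y div 2) \<le> bits n" "bits (x + (y + 1) div 2) \<le> bits n" "bits (x + y) \<le> bits n"
      using that by (auto intro!: bits_mono)
    then show ?thesis by (cases p) auto
  qed
  have "ones (takeWhile (\<lambda>a. \<not> is_head a) s) + ones (dropWhile (\<lambda>a. \<not> is_head a) s) = ones s"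
    by (metis ones_simps(3) takeWhile_dropWhile_id)
  then have "turns_single (hd (filter is_head s)) (ones (takeWhile (\<lambda>a. \<not> is_head a) s))
      (ones (dropWhile (\<lambda>a. \<not> is_head a) s)) \<le> 2 * bits (length s) + 2"
    using ones_le_length[of s] by (intro *) simp
  then show ?thesis unfolding turns_def Let_def by auto
qed

lemma turns_crossing:
  assumes "(l, r) \<in> crossing"
  shows "turns (\<alpha> @ r @ \<beta>) = turns (\<alpha> @ l @ \<beta>)"
proof (cases "filter is_head \<alpha> @ filter is_head \<beta> = []")
  case True
  then have nh: "\<forall>a\<in>set \<alpha>. \<not> is_head a" "\<forall>a\<in>set \<beta>. \<not> is_head a"
    by (auto simp: filter_empty_conv)
  have "turns (\<alpha> @ p # a # \<beta>) = turns_single p (ones \<alpha>) (ones (a # \<beta>))"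
    "turns (\<alpha> @ a # p # \<beta>) = turns_single p (ones \<alpha> + ones [a]) (ones \<beta>)"
    if "is_head p" "\<not> is_head a" for p a
    using that nh turns_one_head[of p \<alpha> "a # \<beta>"] turns_one_head[of p "\<alpha> @ [a]" \<beta>] by auto
  then show ?thesis using assms unfolding crossing_def by auto
next
  case False
  obtain p p' where p: "filter is_head l = [p]" "filter is_head r = [p']" "p = C \<longleftrightarrow> p' = C"
    using assms unfolding crossing_def by auto
  show ?thesis
    using False p
    by (simp add: turns_many_heads[of _ "filter is_head \<alpha>" p "filter is_head \<beta>"]
      turns_many_heads[of _ "filter is_head \<alpha>" p' "filter is_head \<beta>"] hd_append)
qed

lemma turns_right_end:
  assumes "h = H1 \<or> h = H2"
  shows "turns (\<alpha> @ [C]) < turns (\<alpha> @ [h])"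
proof (cases "filter is_head \<alpha> = []")
  case True
  then have "\<forall>a\<in>set \<alpha>. \<not> is_head a" by (auto simp: filter_empty_conv)
  then show ?thesis using assms turns_one_head[of _ \<alpha> "[]"] by auto
next
  case False
  then show ?thesis using assms
    by (auto simp: turns_many_heads[of _ "filter is_head \<alpha>" _ "[]"] hd_append)
qed

lemma turns_left_end: "turns (H0 # \<beta>) < turns (C # \<beta>)"
proof (cases "filter is_head \<beta> = []")
  case True
  then have "\<forall>a\<in>set \<beta>. \<not> is_head a" by (auto simp: filter_empty_conv)
  then show ?thesis using turns_one_head[of _ "[]" \<beta>] by (auto simp: bits_pos)
next
  case False
  then show ?thesis 
    by (auto simp: turns_many_heads[of _ "[]" _ "filter is_head \<beta>"])
qed

text \<open>A turn may make up to \<open>length s\<close> letters crossable again, hence the weight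
  \<open>length s + 1\<close> of a turn.\<close>
definition seg_potential :: "letter list \<Rightarrow> nat" where
  "seg_potential s = (length s + 1) * turns s + crossable s"

lemma seg_potential_crossing:
  assumes "(l, r) \<in> crossing"
  shows "seg_potential (\<alpha> @ r @ \<beta>) < seg_potential (\<alpha> @ l @ \<beta>)"
proof -
  have "length l = length r" using assms unfolding crossing_def by auto
  then show ?thesis
    using turns_crossing[OF assms] crossable_crossing[OF assms] by (simp add: seg_potential_def)
qed

lemma seg_potential_turn:
  assumes "turns s' < turns s" "length s' = length s"
  shows "seg_potential s' < seg_potential s"
proof -
  have "seg_potential s' < (length s + 1) * turns s' + (length s + 1)"
    using crossable_le[of s'] assms(2) by (simp add: seg_potential_def)
  also have "\<dots> = (length s + 1) * Suc (turns s')" by simp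
  also have "\<dots> \<le> (length s + 1) * turns s" using assms(1) by (intro mult_le_mono) auto
  also have "\<dots> \<le> seg_potential s" by (simp add: seg_potential_def)
  finally show ?thesis .
qed

lemma seg_potential_le:
  assumes "length s \<le> n"
  shows "seg_potential s \<le> (length s + 1) * (2 * bits n + 3)"
proof -
  have "turns s \<le> 2 * bits n + 2"
    using turns_le[of s] bits_mono[OF assms] by simp
  then have "(length s + 1) * turns s \<le> (length s + 1) * (2 * bits n + 2)"
    by (rule mult_le_mono2)
  then show ?thesis
    using crossable_le[of s] unfolding seg_potential_def by (simp add: algebra_simps)
qed

section \<open>The potential of a word\<close>

fun segments :: "letter list \<Rightarrow> letter list list" where
  "segments [] = [[]]"
| "segments (a # u) = (if a = W then [] # segments u else (a # hd (segments u)) # tl (segments u))"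

lemma segments_nonempty [simp]: "segments u \<noteq> []"
  by (cases u) auto

definition potential :: "letter list \<Rightarrow> nat" where
  "potential u = (\<Sum>s\<leftarrow>segments u. seg_potential s)"

lemma segments_W: "segments (u @ W # v) = segments u @ segments v"
  by (induction u) auto

lemma potential_W: "potential (u @ W # v) = potential u + potential v"
  by (simp add: potential_def segments_W)

lemma potential_segment: "W \<notin> set s \<Longrightarrow> potential s = seg_potential s"
proof -
  assume "W \<notin> set s"
  then have "segments s = [s]" by (induction s) auto
  then show ?thesis by (simp add: potential_def)
qed

text \<open>The potential is additive where a word is split at a \<open>W\<close>, so the context may be cut
  off at the nearest \<open>W\<close> on either side.\<close>
lemma potential_less_context:
  assumes less: "\<And>\<alpha> \<beta>. W \<notin> set \<alpha> \<Longrightarrow> W \<notin> set \<beta> \<Longrightarrow> potential (\<alpha> @ r @ \<beta>) < potential (\<alpha> @ l @ \<beta>)"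
  shows "potential (\<alpha> @ r @ \<beta>) < potential (\<alpha> @ l @ \<beta>)"
proof -
  have right: "potential (\<alpha> @ r @ \<beta>) < potential (\<alpha> @ l @ \<beta>)" if "W \<notin> set \<alpha>" for \<alpha>
  proof (cases "W \<in> set \<beta>")
    case True
    then obtain \<gamma> \<delta> where "\<beta> = \<gamma> @ W # \<delta>" "W \<notin> set \<gamma>" by (meson split_list_first)
    then show ?thesis
      using less[OF that, of \<gamma>] potential_W[of "\<alpha> @ r @ \<gamma>" \<delta>] potential_W[of "\<alpha> @ l @ \<gamma>" \<delta>]
      by simp
  qed (use that less in blast)
  show ?thesis
  proof (cases "W \<in> set \<alpha>")
    case True
    then obtain \<gamma> \<delta> where "\<alpha> = \<gamma> @ W # \<delta>" "W \<notin> set \<delta>" by (meson split_list_last)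
    then show ?thesis using right[of \<delta>] by (simp add: potential_W)
  qed (rule right)
qed

lemma potential_crossing:
  assumes "(l, r) \<in> crossing"
  shows "potential (\<alpha> @ r @ \<beta>) < potential (\<alpha> @ l @ \<beta>)"
proof (rule potential_less_context)
  fix \<alpha> \<beta> :: "letter list"
  assume "W \<notin> set \<alpha>" "W \<notin> set \<beta>"
  moreover have "W \<notin> set l" "W \<notin> set r" using assms unfolding crossing_def by auto
  ultimately show "potential (\<alpha> @ r @ \<beta>) < potential (\<alpha> @ l @ \<beta>)"
    using seg_potential_crossing[OF assms] by (simp add: potential_segment)
qed

lemma potential_right_end:
  assumes "h = H1 \<or> h = H2"
  shows "potential (\<alpha> @ [C, W] @ \<beta>) < potential (\<alpha> @ [h, W] @ \<beta>)"
proof (rule potential_less_context)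
  fix \<alpha> \<beta> :: "letter list"
  assume "W \<notin> set \<alpha>" 
  then have "potential (\<alpha> @ [C]) < potential (\<alpha> @ [h])"
    using assms by (auto simp: potential_segment intro!: seg_potential_turn turns_right_end)
  then show "potential (\<alpha> @ [C, W] @ \<beta>) < potential (\<alpha> @ [h, W] @ \<beta>)"
    using potential_W[of "\<alpha> @ [C]"] potential_W[of "\<alpha> @ [h]"] by simp
qed

lemma potential_left_end: "potential (\<alpha> @ [W, H0] @ \<beta>) < potential (\<alpha> @ [W, C] @ \<beta>)"
proof (rule potential_less_context)
  fix \<alpha> \<beta> :: "letter list"
  assume "W \<notin> set \<beta>" 
  then have "potential (H0 # \<beta>) < potential (C # \<beta>)"
    by (auto simp: potential_segment intro!: seg_potential_turn turns_left_end)
  then show "potential (\<alpha> @ [W, H0] @ \<beta>) < potential (\<alpha> @ [W, C] @ \<beta>)"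
    by (simp add: potential_W)
qed

lemma potential_decreases:
  assumes "step u v"
  shows "potential v < potential u"
proof -
  obtain \<alpha> \<beta> l r where lr: "(l, r) \<in> rules0" "u = \<alpha> @ l @ \<beta>" "v = \<alpha> @ r @ \<beta>"
    using assms unfolding rewrite_step_def by blast
  have "(l, r) \<in> crossing \<or> (\<exists>h. (h = H1 \<or> h = H2) \<and> l = [h, W] \<and> r = [C, W])
      \<or> l = [W, C] \<and> r = [W, H0]"
    using lr(1) unfolding rules0_def insert_iff empty_iff prod.inject
    by (elim disjE) (simp_all add: crossing_def)
  then consider "(l, r) \<in> crossing" | h where "h = H1 \<or> h = H2" "l = [h, W]" "r = [C, W]"
    | "l = [W, C]" "r = [W, H0]"
    by blast
  then show ?thesis
  proof cases
    case 1
    then show ?thesis unfolding lr(2,3) by (rule potential_crossing)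
  next
    case 2
    then show ?thesis unfolding lr(2,3) by (simp only: potential_right_end)
  next
    case 3
    then show ?thesis unfolding lr(2,3) by (simp only: potential_left_end)
  qed
qed

lemma sum_list_length_segments: "(\<Sum>s\<leftarrow>segments u. length s + 1) = length u + 1"
proof (induction u)
  case (Cons a u)
  then show ?case by (cases "segments u") auto
qed simp

lemma length_segment_le: "s \<in> set (segments u) \<Longrightarrow> length s \<le> length u"
proof -
  assume "s \<in> set (segments u)"
  then have "length s + 1 \<le> (\<Sum>s\<leftarrow>segments u. length s + 1)"
    by (intro member_le_sum_list) auto
  then show ?thesis by (simp only: sum_list_length_segments)
qed

lemma potential_le:
  assumes "length u \<le> n"
  shows "potential u \<le> (length u + 1) * (2 * bits n + 3)"
proof -
  have "potential u \<le> (\<Sum>s\<leftarrow>segments u. (length s + 1) * (2 * bits n + 3))"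
    unfolding potential_def
  proof (rule sum_list_mono)
    fix s assume "s \<in> set (segments u)"
    then have "length s \<le> n" using length_segment_le assms by fastforce
    then show "seg_potential s \<le> (length s + 1) * (2 * bits n + 3)"
      by (rule seg_potential_le)
  qed
  also have "\<dots> = (length u + 1) * (2 * bits n + 3)"
    by (simp only: sum_list_mult_const sum_list_length_segments)
  finally show ?thesis .
qed

section \<open>The upper bound\<close>

lemma rewrite_dist_le_potential:
  assumes "rewrite_equiv rules0 u v"
  shows "rewrite_dist rules0 u v \<le> potential u + potential v"
proof -
  \<comment> \<open>The path from \<open>u\<close> to \<open>v\<close> may be long; it is only used to see that the normal form of \<open>v\<close> is also
    that of \<open>u\<close>, and is then replaced by the detour through this normal form.\<close>
  obtain b t where t: "(step ^^ b) v t" "normal step t"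
    using ex_normal_form[of step potential v] potential_decreases by blast
  obtain a where a: "(step ^^ a) u t"
    using descent_along_zigzag[OF diamond_step t(2) t(1) rewrite_dist_attained[OF assms]]
    by blast
  have "(symclp step ^^ (a + b)) u v"
    using relpowp_add_I[OF relpowp_symclp[OF a] relpowp_symclp_sym[OF relpowp_symclp[OF t(1)]]] .
  then have "rewrite_dist rules0 u v \<le> a + b"
    unfolding rewrite_dist_def by (rule Least_le)
  also have "\<dots> \<le> potential u + potential v"
    using relpowp_le_potential[of step potential, OF potential_decreases] a t(1)
    by (meson add_mono)
  finally show ?thesis .
qed

lemma dehn_le: "dehn rules0 n \<le> (n + 2) * (2 * bits n + 3)"
proof -
  have bound: "rewrite_dist rules0 u v \<le> (n + 2) * (2 * bits n + 3)"
    if "rewrite_equiv rules0 u v" "length u + length v \<le> n" for u v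
  proof -
    let ?K = "2 * bits n + 3"
    have "length u \<le> n" "length v \<le> n" using that(2) by simp_all
    then have "potential u + potential v \<le> (length u + 1) * ?K + (length v + 1) * ?K"
      by (rule add_mono[OF potential_le potential_le])
    also have "\<dots> = ((length u + 1) + (length v + 1)) * ?K"
      by (rule distrib_right[symmetric])
    also have "\<dots> \<le> (n + 2) * ?K"
      using that(2) by (intro mult_le_mono1) simp
    finally have "potential u + potential v \<le> (n + 2) * ?K" .
    with rewrite_dist_le_potential[OF that(1)] show ?thesis by (rule order.trans)
  qed
  show ?thesis
    unfolding dehn_def
  proof (rule Max.boundedI[OF finite_dehn_set dehn_set_nonempty], clarify)
    fix u v :: "letter list"
    assume "rewrite_equiv rules0 u v" "length u + length v \<le> n"
    then show "rewrite_dist rules0 u v \<le> (n + 2) * (2 * bits n + 3)" by (rule bound)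
  qed
qed

section \<open>The lower bound\<close>

fun bar :: "letter \<Rightarrow> letter" where
  "bar Z = Zb"
| "bar I = Ib"
| "bar a = a"

lemma steps_context: "(step ^^ k) u v \<Longrightarrow> (step ^^ k) (\<alpha> @ u @ \<beta>) (\<alpha> @ v @ \<beta>)"
proof (induction k arbitrary: v)
  case (Suc k)
  then obtain v' where v': "(step ^^ k) u v'" "step v' v" by (meson relpowp_Suc_E)
  show ?case by (rule relpowp_Suc_I[of k step, OF Suc.IH[OF v'(1)] step_context[OF v'(2)]])
qed simp

text \<open>Reading the ones from left to right, \<open>H0\<close> and \<open>H2\<close> erase the next one
  while \<open>H1\<close> keeps it; so half of the ones survive, rounded up if the sweep starts in
  \<open>H1\<close>.\<close>
lemma right_sweep:
  assumes "set x \<subseteq> {Z, I}" "h \<in> {H0, H1, H2}"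
  shows "\<exists>y h'. set y \<subseteq> {Z, I} \<and> length y = length x
    \<and> ones y = (ones x + of_bool (h = H1)) div 2
    \<and> h' \<in> {H0, H1, H2} \<and> (h' = H0 \<longleftrightarrow> h = H0 \<and> ones x = 0)
    \<and> (step ^^ length x) (h # x) (map bar y @ [h'])"
  using assms
proof (induction x arbitrary: h)
  case Nil
  then show ?case by (intro exI[of _ "[]"] exI[of _ h]) auto
next
  case (Cons a x)
  obtain b g where bg: "b \<in> {Z, I}" "g \<in> {H0, H1, H2}" "([h, a], [bar b, g]) \<in> rules0"
    "ones [b] + (ones x + of_bool (g = H1)) div 2 = (ones (a # x) + of_bool (h = H1)) div 2"
    "g = H0 \<longleftrightarrow> h = H0 \<and> a = Z"
  proof -
    have "a = Z \<or> a = I" "h = H0 \<or> h = H1 \<or> h = H2" using Cons.prems by auto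
    then consider "a = Z" | "a = I" "h = H0 \<or> h = H2" | "a = I" "h = H1" by blast
    then show thesis
    proof cases
      case 1
      then show ?thesis using that[of Z h] Cons.prems(2) by (auto simp: rules0_def)
    next
      case 2
      then show ?thesis using that[of Z H1] by (auto simp: rules0_def)
    next
      case 3
      then show ?thesis using that[of I H2] by (auto simp: rules0_def)
    qed
  qed
  obtain y h' where y: "set y \<subseteq> {Z, I}" "length y = length x"
    "ones y = (ones x + of_bool (g = H1)) div 2"
    "h' \<in> {H0, H1, H2}" "h' = H0 \<longleftrightarrow> g = H0 \<and> ones x = 0"
    "(step ^^ length x) (g # x) (map bar y @ [h'])"
    using Cons.IH[of g] Cons.prems(1) bg(2) by auto
  have "(step ^^ length x) (bar b # g # x) (bar b # map bar y @ [h'])"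
    using steps_context[OF y(6), of "[bar b]" "[]"] by simp
  then have steps: "(step ^^ length (a # x)) (h # a # x) (map bar (b # y) @ [h'])"
    using relpowp_Suc_I2[of step, OF step_head[OF bg(3)]] by (simp del: relpowp.simps)
  have ones: "ones (b # y) = (ones (a # x) + of_bool (h = H1)) div 2"
    using bg(4) y(3) by (auto split: if_splits)
  have head: "h' = H0 \<longleftrightarrow> h = H0 \<and> ones (a # x) = 0"
    using y(5) bg(5) Cons.prems(1) by auto
  have word: "set (b # y) \<subseteq> {Z, I}" "length (b # y) = length (a # x)"
    using y(1,2) bg(1) by simp_all
  show ?case
    by (rule exI[of _ "b # y"], rule exI[of _ h'])
      (rule conjI[OF word(1) conjI[OF word(2) conjI[OF ones conjI[OF y(4) conjI[OF head steps]]]]])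
qed

lemma left_sweep: "set y \<subseteq> {Z, I} \<Longrightarrow> (step ^^ length y) (map bar y @ [C]) (C # y)"
proof (induction y)
  case (Cons a y)
  then have "(step ^^ length y) (bar a # map bar y @ [C]) (bar a # C # y)"
    using steps_context[of _ "map bar y @ [C]" "C # y" "[bar a]" "[]"] by simp
  moreover have "step (bar a # C # y) (C # a # y)"
    using Cons.prems by (intro step_head) (auto simp: rules0_def)
  ultimately have "(step ^^ Suc (length y)) (bar a # map bar y @ [C]) (C # a # y)"
    by (rule relpowp_Suc_I)
  then show ?case by (simp del: relpowp.simps)
qed simp

lemma full_pass:
  assumes "set x \<subseteq> {Z, I}" "ones x > 0"
  shows "\<exists>y. set y \<subseteq> {Z, I} \<and> length y = length x \<and> ones y = ones x div 2
    \<and> (step ^^ (2 * length x + 2)) (W # H0 # x @ [W]) (W # H0 # y @ [W])"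
proof -
  obtain y h where y: "set y \<subseteq> {Z, I}" "length y = length x" "ones y = ones x div 2"
    "h \<in> {H1, H2}" "(step ^^ length x) (H0 # x) (map bar y @ [h])"
    using right_sweep[OF assms(1), of H0] assms(2) by auto
  have right: "(step ^^ length x) (W # H0 # x @ [W]) (W # map bar y @ [h, W])"
    using steps_context[OF y(5), of "[W]" "[W]"] by simp
  have turn_right: "step (W # map bar y @ [h, W]) (W # map bar y @ [C, W])"
    using step_context[OF step_head[of h W C W "[]"], of "W # map bar y" "[]"] y(4)
    by (auto simp: rules0_def)
  have left: "(step ^^ length x) (W # map bar y @ [C, W]) (W # C # y @ [W])"
    using steps_context[OF left_sweep[OF y(1)], of "[W]" "[W]"] y(2) by simp
  have turn_left: "step (W # C # y @ [W]) (W # H0 # y @ [W])"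
    by (intro step_head) (auto simp: rules0_def)
  have "(step ^^ Suc (Suc (length x) + length x)) (W # H0 # x @ [W]) (W # H0 # y @ [W])"
    by (rule relpowp_Suc_I[OF relpowp_add_I[OF relpowp_Suc_I[OF right turn_right] left] turn_left])
  moreover have "Suc (Suc (length x) + length x) = 2 * length x + 2" by simp
  ultimately show ?thesis using y(1-3) by metis
qed

text \<open>Each pass over \<open>x\<close> takes one binary digit off the number of ones, and costs more than
  \<open>length x\<close> steps. Once the ones are used up, a last sweep to the right leads to a word in which
  the head is stuck at \<open>W\<close>.\<close>
lemma long_derivation:
  "set x \<subseteq> {Z, I} \<Longrightarrow> \<exists>a \<ge> length x * bits (ones x).
     (step ^^ a) (W # H0 # x @ [W]) (W # replicate (length x) Zb @ [H0, W])"
proof (induction "ones x" arbitrary: x rule: bits.induct)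
  case 1
  show ?case
  proof (cases "ones x = 0")
    case True
    obtain y where y: "set y \<subseteq> {Z, I}" "length y = length x" "ones y = 0"
      "(step ^^ length x) (H0 # x) (map bar y @ [H0])"
      using right_sweep[OF "1.prems", of H0] True by auto
    have "map bar y = replicate (length y) Zb" using y(1,3) by (induction y) auto
    then show ?thesis using steps_context[OF y(4), of "[W]" "[W]"] True y(2) by auto
  next
    case False
    obtain y where y: "set y \<subseteq> {Z, I}" "length y = length x" "ones y = ones x div 2"
      "(step ^^ (2 * length x + 2)) (W # H0 # x @ [W]) (W # H0 # y @ [W])"
      using full_pass[OF "1.prems"] False by blast
    obtain a where a: "a \<ge> length y * bits (ones y)"
      "(step ^^ a) (W # H0 # y @ [W]) (W # replicate (length y) Zb @ [H0, W])"
      using "1.hyps"[OF False _ y(1)] y(3) by auto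
    have "(step ^^ (2 * length x + 2 + a)) (W # H0 # x @ [W]) (W # replicate (length x) Zb @ [H0, W])"
      using relpowp_add_I[OF y(4) a(2)] y(2) by simp
    moreover have "length x * bits (ones x) \<le> 2 * length x + 2 + a"
      using a(1) y(2,3) False by (simp add: bits_pos)
    ultimately show ?thesis by blast
  qed
qed

lemma final_word_normal: "normal step (W # replicate n Zb @ [H0, W])"
proof -
  \<comment> \<open>The potential vanishes, and it would have to decrease in any further step.\<close>
  have "exposed P T False (replicate n Zb @ [H0]) = 0" for P T
    by (induction n) auto
  moreover have "exposed P T False (replicate n Zb) = 0" for P T
    by (induction n) auto
  ultimately have "crossable (replicate n Zb @ [H0]) = 0"
    by (simp add: crossable_def)
  moreover have "turns (replicate n Zb @ [H0]) = 0"
    using turns_one_head[of H0 "replicate n Zb" "[]"] by simp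
  ultimately have "potential (replicate n Zb @ [H0]) = 0"
    by (simp add: potential_segment seg_potential_def)
  moreover have "potential [] = 0"
    by (simp add: potential_segment seg_potential_def turns_def crossable_def)
  ultimately have "potential (W # replicate n Zb @ [H0, W]) = 0"
    using potential_W[of "[]" "replicate n Zb @ [H0, W]"] potential_W[of "replicate n Zb @ [H0]" "[]"]
    by simp
  then show ?thesis using potential_decreases by fastforce
qed

lemma dehn_ge:
  assumes "2 * m + 6 \<le> n"
  shows "m * bits m \<le> dehn rules0 n"
proof -
  let ?u = "W # H0 # replicate m I @ [W]" and ?v = "W # replicate m Zb @ [H0, W]"
  have m: "ones (replicate m I) = m" by (induction m) auto
  have "set (replicate m I) \<subseteq> {Z, I}" by (auto simp: set_replicate_conv_if)
  then obtain a where a: "a \<ge> m * bits m" "(step ^^ a) ?u ?v"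
    using long_derivation[of "replicate m I"] by (auto simp: m)
  have eq: "rewrite_equiv rules0 ?u ?v"
    using relpowp_symclp[OF a(2)] unfolding rewrite_equiv_def equivclp_def
    by (rule relpowp_imp_rtranclp)
  obtain b where b: "b \<le> rewrite_dist rules0 ?u ?v" "(step ^^ b) ?u ?v"
    using descent_along_zigzag[OF diamond_step final_word_normal _ rewrite_dist_attained[OF eq],
      where b = 0] by auto
  have "a = b"
    using descent_length_unique[OF diamond_step final_word_normal a(2) b(2)] .
  moreover have "rewrite_dist rules0 ?u ?v \<le> dehn rules0 n"
    unfolding dehn_def using eq assms
    by (intro Max_ge finite_dehn_set CollectI exI[of _ ?u] exI[of _ ?v]) simp
  ultimately show ?thesis using a(1) b(1) by simp
qed

theorem mainTheorem1:
  shows "growth_equiv (\<lambda>n. real (dehn rules0 n)) (\<lambda>n. real n * log 2 (real n))"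
  unfolding growth_equiv_def
proof
  show "growth_le (\<lambda>n. real (dehn rules0 n)) (\<lambda>n. real n * log 2 (real n))"
    unfolding growth_le_def
  proof (rule exI[of _ "14::nat"], rule conjI, simp, rule exI[of _ "1::nat"], intro allI impI)
    \<comment> \<open>For \<open>n \<ge> 2\<close> the factors in \<open>dehn_le\<close> are at most \<open>2 n\<close> and \<open>7 log n\<close>.\<close>
    fix n :: nat assume n: "n > 1"
    have l1: "1 \<le> log 2 (real n)"
      using n by (simp add: le_log_iff)
    have "real (dehn rules0 n) \<le> real ((n + 2) * (2 * bits n + 3))"
      using dehn_le[of n] by (simp only: of_nat_le_iff)
    also have "\<dots> = (real n + 2) * (2 * real (bits n) + 3)" by (simp add: algebra_simps)
    also have "\<dots> \<le> (2 * real n) * (7 * log 2 (real n))"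
    proof (rule mult_mono)
      show "2 * real (bits n) + 3 \<le> 7 * log 2 (real n)"
        using l1 bits_le_log[of n] n by linarith
    qed (use n in auto)
    also have "\<dots> = 14 * (real n * log 2 (real n))" by simp
    also have "\<dots> \<le> 14 * (real (14 * n) * log 2 (real (14 * n)))"
      using n l1 by (intro mult_left_mono mult_mono) auto
    finally show "real (dehn rules0 n) \<le> real 14 * (real (14 * n) * log 2 (real (14 * n)))
        + real 14 * real n + real 14"
      by simp
  qed
next
  show "growth_le (\<lambda>n. real n * log 2 (real n)) (\<lambda>n. real (dehn rules0 n))"
    unfolding growth_le_def
  proof (rule exI[of _ "8::nat"], rule conjI, simp, rule exI[of _ "0::nat"], intro allI impI)
    \<comment> \<open>The run on \<open>n\<close> ones joins words of total length \<open>2 n + 6 \<le> 8 n\<close>.\<close>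
    fix n :: nat assume n: "n > 0"
    have "real n * log 2 (real n) \<le> real n * real (bits n)"
      using n log_le_bits by (intro mult_left_mono) auto
    also have "\<dots> = real (n * bits n)" by simp
    also have "\<dots> \<le> real (dehn rules0 (8 * n))"
    proof (rule of_nat_mono)
      show "n * bits n \<le> dehn rules0 (8 * n)" using n by (intro dehn_ge) simp
    qed
    finally show "real n * log 2 (real n) \<le> real 8 * real (dehn rules0 (8 * n))
        + real 8 * real n + real 8"
      by simp
  qed
qed

end
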